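(* Let $n$ and $k$, $0\le k\le n$, be integers. The number $P_{(x_{12}x_{23})^n(x_{34})^k}(\beta=0)$ is equal to the number of $n$ up, $n$ down, $k$ up permutations in the symmetric group $\mathbb{S}_{2n+k+1}$, that is, the number of $\sigma\in\mathbb{S}_{2n+k+1}$ with $$\sigma(1)<\cdots<\sigma(n+1)>\sigma(n+2)>\cdots>\sigma(2n+1)<\sigma(2n+2)<\cdots<\sigma(2n+k+1).$$
   Context: For a monomial $M$ in commuting variables $x_{ij}$, $i<j$, over $\mathbb{Z}[\beta]$, a reduced polynomial of $M$ is obtained by repeatedly replacing (in any monomial) a product $x_{ij}x_{jk}$, $i<j<k$, by $x_{ik}x_{ij}+x_{jk}x_{ik}+\beta x_{ik}$, until no monomial contains such a product. $P_M(\beta)$ denotes the value of the reduced polynomial at $x_{ij}=1$ for all $i<j$ (the replacements are applied successively starting from the leftmost variables $x_{12}^{m_1}x_{23}$). *)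

theory Defs
  imports
    "HOL-Library.Poly_Mapping"
    "HOL-Computational_Algebra.Polynomial"
    "HOL-Combinatorics.Permutations"
begin

text \<open>
  The variable \<open>x\<^bsub>ij\<^esub>\<close> is indexed by the pair \<open>(i, j)\<close>. A monomial is its exponent vector, so a
  product of monomials is a sum of exponent vectors. The ring \<open>\<int>[\<beta>]\<close> is \<^typ>\<open>int poly\<close>.
\<close>

type_synonym monomial = "nat \<times> nat \<Rightarrow>\<^sub>0 nat"
type_synonym xpoly = "monomial \<Rightarrow>\<^sub>0 int poly"

definition \<beta> :: "int poly" where
  "\<beta> = [:0, 1:]"

definition expo :: "nat \<Rightarrow> nat \<Rightarrow> monomial" where
  "expo i j = Poly_Mapping.single (i, j) 1"

definition xterm :: "int poly \<Rightarrow> monomial \<Rightarrow> xpoly" where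
  "xterm c m = Poly_Mapping.single m c"

definition X :: "nat \<Rightarrow> nat \<Rightarrow> xpoly" where
  "X i j = xterm 1 (expo i j)"

definition xeval :: "(nat \<times> nat \<Rightarrow> int poly) \<Rightarrow> xpoly \<Rightarrow> int poly" where
  "xeval v p = (\<Sum>m\<in>Poly_Mapping.keys p. Poly_Mapping.lookup p m *
     (\<Prod>e\<in>Poly_Mapping.keys m. v e ^ Poly_Mapping.lookup m e))"

definition contains_product :: "monomial \<Rightarrow> nat \<Rightarrow> nat \<Rightarrow> nat \<Rightarrow> bool" where
  "contains_product m i j k \<longleftrightarrow> i < j \<and> j < k \<and> (\<exists>m'. m = expo i j + expo j k + m')"

text \<open>
  The leftmost product \<open>x\<^bsub>ij\<^esub> x\<^bsub>jk\<^esub>\<close> in a monomial: the variables are ordered lexicographically,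
  \<open>x\<^bsub>12\<^esub>, x\<^bsub>13\<^esub>, \<dots>, x\<^bsub>23\<^esub>, \<dots>\<close>, and products are compared by their first, then their second factor.
\<close>

definition leftmost_product :: "monomial \<Rightarrow> nat \<Rightarrow> nat \<Rightarrow> nat \<Rightarrow> bool" where
  "leftmost_product m i j k \<longleftrightarrow> contains_product m i j k \<and>
     (\<forall>i' j' k'. contains_product m i' j' k' \<longrightarrow>
        i < i' \<or> i = i' \<and> (j < j' \<or> j = j' \<and> k \<le> k'))"

text \<open>
  One replacement: the term \<open>c x\<^bsub>ij\<^esub> x\<^bsub>jk\<^esub> m\<close> of \<open>p\<close> becomes
  \<open>c (x\<^bsub>ik\<^esub> x\<^bsub>ij\<^esub> + x\<^bsub>jk\<^esub> x\<^bsub>ik\<^esub> + \<beta> x\<^bsub>ik\<^esub>) m\<close>. The term is chosen freely.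
\<close>

inductive replacement :: "xpoly \<Rightarrow> xpoly \<Rightarrow> bool" where
  "\<lbrakk>expo i j + expo j k + m \<in> Poly_Mapping.keys p;
    leftmost_product (expo i j + expo j k + m) i j k;
    c = Poly_Mapping.lookup p (expo i j + expo j k + m)\<rbrakk>
   \<Longrightarrow> replacement p
        (p - xterm c (expo i j + expo j k + m)
           + xterm c m * (X i k * X i j + X j k * X i k + xterm \<beta> 0 * X i k))"

definition reduced :: "xpoly \<Rightarrow> bool" where
  "reduced p \<longleftrightarrow> (\<forall>m\<in>Poly_Mapping.keys p. \<nexists>i j k. contains_product m i j k)"

definition reduced_polynomial :: "xpoly \<Rightarrow> xpoly" where
  "reduced_polynomial M = (THE Q. replacement\<^sup>*\<^sup>* M Q \<and> reduced Q)"

definition P :: "xpoly \<Rightarrow> int poly" where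
  "P M = xeval (\<lambda>_. 1) (reduced_polynomial M)"

definition up_down_up_permutations :: "nat \<Rightarrow> nat \<Rightarrow> (nat \<Rightarrow> nat) set" where
  "up_down_up_permutations n k = {\<sigma>. \<sigma> permutes {1..2 * n + k + 1} \<and>
     (\<forall>i\<in>{1..n}. \<sigma> i < \<sigma> (i + 1)) \<and>
     (\<forall>i\<in>{n + 1..2 * n}. \<sigma> i > \<sigma> (i + 1)) \<and>
     (\<forall>i\<in>{2 * n + 1..2 * n + k}. \<sigma> i < \<sigma> (i + 1))}"

end

theory Submission
  imports Defs "HOL-Combinatorics.Multiset_Permutations"
begin

text \<open>
  At \<open>\<beta> = 0\<close> a replacement turns a monomial into two monomials, so the value of the reduced polynomial
  at \<open>x\<^bsub>ij\<^esub> = 1\<close> is the number of leaves of a binary tree (\<open>leaves_step\<close>). For this to make sense, the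
  reduced polynomial has to exist and be unique. It exists because the new monomials have smaller weight
  (\<open>replacement_decreases_weight\<close>), and it is unique because the linear extension of the normal form of
  monomials is invariant under replacement (\<open>reduced_polynomial_eq\<close>).

  Let \<open>h(a, b, d)\<close> be the number of leaves below \<open>x\<^bsub>12\<^esub>\<^sup>a x\<^bsub>13\<^esub>\<^sup>b x\<^bsub>23\<^esub>\<^sup>d x\<^bsub>34\<^esub>\<^sup>k\<close>. As long as \<open>a\<close> and \<open>d\<close> are
  positive, \<open>h(a, b, d) = h(a, b + 1, d - 1) + h(a - 1, b + 1, d)\<close>. So the sum \<open>s = a + b + d\<close> is constant,
  equal to \<open>2n\<close> for the given monomial, and \<open>h\<close> satisfies Pascal's rule in \<open>a\<close> and \<open>d\<close>. Once \<open>a = 0\<close> or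
  \<open>d = 0\<close>, the rest of the tree counts lattice paths, and \<open>h\<close> is \<open>(s + k) choose k\<close> or
  \<open>(s - a + k) choose k\<close>, respectively.

  On the other side, let \<open>w(a, d, k)\<close> be the number of arrangements of \<open>t = a + d + k + 1\<close> values with
  \<open>a\<close> ascents, \<open>d\<close> descents and \<open>k\<close> ascents. Leaving the first of the last \<open>k\<close> steps free gives
  \<open>w(a, d, k) + w(a, d + 1, k - 1) = (t choose k) ((a + d) choose a)\<close> (\<open>card_words_split\<close>). Extend \<open>w\<close> by this
  recursion, with \<open>t\<close> fixed, to all \<open>a\<close> and \<open>d\<close> (\<open>ribbon\<close>). The extension satisfies Pascal's rule in
  \<open>a\<close> and \<open>d\<close> since \<open>(a + d) choose a\<close> does (\<open>ribbon_pascal\<close>), and for \<open>t = s + k + 1\<close> its values at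
  \<open>a = 0\<close> and \<open>d = 0\<close> are those of \<open>h\<close>. Hence the two agree everywhere (\<open>leaves_ribbon\<close>), and the theorem is
  the case \<open>a = d = n\<close>.
\<close>

section \<open>Existence and uniqueness of reduced polynomials\<close>

lemma xterm_add: "xterm (c + d) m = xterm c m + xterm d m"
  by (simp add: xterm_def single_add)

lemma xterm_mult: "xterm c m * xterm d m' = xterm (c * d) (m + m')"
  by (simp add: xterm_def mult_single)

lemma keys_xterm: "Poly_Mapping.keys (xterm c m) \<subseteq> {m}"
  by (simp add: xterm_def)

lemma one_xterm: "xterm 1 0 = 1"
  by (simp add: xterm_def)

lemma replacement_result:
  "xterm c m * (X i k * X i j + X j k * X i k + xterm \<beta> 0 * X i k) =
      xterm c (expo i k + expo i j + m) + xterm c (expo j k + expo i k + m)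
      + xterm (c * \<beta>) (expo i k + m)"
  by (simp add: X_def xterm_mult algebra_simps)

text \<open>
  Bounding the indices by \<open>N\<close> makes a single weight decrease in all three monomials produced by a
  replacement. The variable \<open>x\<^bsub>ij\<^esub>\<close> weighs \<open>N - (j - i)\<close>, so a replacement lowers the weight by making
  an index pair longer, and in the \<open>\<beta>\<close>-term by losing a variable. Summing over a fixed square of
  indices, and not over the support of \<open>m\<close>, makes the weight additive at once.
\<close>

definition bounded_by :: "nat \<Rightarrow> monomial \<Rightarrow> bool" where
  "bounded_by N m \<longleftrightarrow> Poly_Mapping.keys m \<subseteq> {..N} \<times> {..N}"

definition weight :: "nat \<Rightarrow> monomial \<Rightarrow> nat" where
  "weight N m = (\<Sum>(i, j)\<in>{..N} \<times> {..N}. Poly_Mapping.lookup m (i, j) * (N + i - j))"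

lemma bounded_by_iff: "bounded_by N m \<longleftrightarrow> (\<forall>e. Poly_Mapping.lookup m e \<noteq> 0 \<longrightarrow> e \<in> {..N} \<times> {..N})"
  by (auto simp: bounded_by_def in_keys_iff subset_iff)

lemma bounded_by_add [simp]: "bounded_by N (m + m') \<longleftrightarrow> bounded_by N m \<and> bounded_by N m'"
  by (auto simp: bounded_by_iff lookup_add)

lemma bounded_by_expo [simp]: "bounded_by N (expo i j) \<longleftrightarrow> i \<le> N \<and> j \<le> N"
  by (simp add: bounded_by_def expo_def)

lemma weight_add [simp]: "weight N (m + m') = weight N m + weight N m'"
  by (simp add: weight_def lookup_add algebra_simps sum.distrib case_prod_beta)

lemma weight_expo [simp]: "i \<le> N \<Longrightarrow> j \<le> N \<Longrightarrow> weight N (expo i j) = N + i - j"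
proof -
  assume ij: "i \<le> N" "j \<le> N"
  have "weight N (expo i j) = (\<Sum>e\<in>{..N} \<times> {..N}. if e = (i, j) then N + i - j else 0)"
    unfolding weight_def expo_def
    by (rule sum.cong) (auto simp: lookup_single when_def split: if_splits)
  then show ?thesis
    using ij by simp
qed

lemma replacement_decreases_weight:
  assumes "bounded_by N (expo i j + expo j k + r)" "i < j" "j < k"
  shows "weight N (expo i k + expo i j + r) < weight N (expo i j + expo j k + r)"
    and "weight N (expo j k + expo i k + r) < weight N (expo i j + expo j k + r)"
    and "weight N (expo i k + r) < weight N (expo i j + expo j k + r)"
  using assms by auto

lemma leftmost_product_exists:
  assumes "contains_product m i j k"
  shows "\<exists>i j k. leftmost_product m i j k"
proof -
  define i0 where "i0 = (LEAST i. \<exists>j k. contains_product m i j k)"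
  define j0 where "j0 = (LEAST j. \<exists>k. contains_product m i0 j k)"
  define k0 where "k0 = (LEAST k. contains_product m i0 j0 k)"
  have 1: "\<exists>j k. contains_product m i0 j k"
    unfolding i0_def by (rule LeastI_ex) (use assms in blast)
  then have 2: "\<exists>k. contains_product m i0 j0 k"
    unfolding j0_def by (rule LeastI_ex)
  then have 3: "contains_product m i0 j0 k0"
    unfolding k0_def by (rule LeastI_ex)
  have "i0 \<le> i'" if "contains_product m i' j' k'" for i' j' k'
    unfolding i0_def by (rule Least_le) (use that in blast)
  moreover have "j0 \<le> j'" if "contains_product m i0 j' k'" for j' k'
    unfolding j0_def by (rule Least_le) (use that in blast)
  moreover have "k0 \<le> k'" if "contains_product m i0 j0 k'" for k'
    unfolding k0_def by (rule Least_le) (use that in blast)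
  ultimately have "leftmost_product m i0 j0 k0"
    unfolding leftmost_product_def using 3 by (metis le_neq_implies_less)
  then show ?thesis by blast
qed

lemma leftmost_product_unique:
  "leftmost_product m i j k \<Longrightarrow> leftmost_product m i' j' k' \<Longrightarrow> i = i' \<and> j = j' \<and> k = k'"
  unfolding leftmost_product_def
  by (elim conjE, drule spec[of _ i'], drule spec[of _ j'], drule spec[of _ k'],
      drule spec[of _ i], drule spec[of _ j], drule spec[of _ k]) linarith

text \<open>
  For a monomial that contains a product the choice is forced: the leftmost product is unique, and
  then \<open>r\<close> is determined by cancellation.
\<close>

definition leftmost_factorization :: "monomial \<Rightarrow> nat \<times> nat \<times> nat \<times> monomial" where
  "leftmost_factorization m = (SOME (i, j, k, r). leftmost_product m i j k \<and> m = expo i j + expo j k + r)"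

lemma leftmost_factorization_eq:
  assumes "leftmost_product (expo i j + expo j k + r) i j k"
  shows "leftmost_factorization (expo i j + expo j k + r) = (i, j, k, r)"
proof -
  let ?m = "expo i j + expo j k + r"
  have "(case leftmost_factorization ?m of (i', j', k', r') \<Rightarrow>
      leftmost_product ?m i' j' k' \<and> ?m = expo i' j' + expo j' k' + r')"
    unfolding leftmost_factorization_def by (rule someI[of _ "(i, j, k, r)"]) (use assms in simp)
  then obtain i' j' k' r' where e: "leftmost_factorization ?m = (i', j', k', r')"
    and l: "leftmost_product ?m i' j' k'" and m: "?m = expo i' j' + expo j' k' + r'"
    by (auto split: prod.splits)
  with leftmost_product_unique[OF assms l] show ?thesis by auto
qed

text \<open>
  The reduction of a single monomial, run to the end. Outside the monomials bounded by \<open>N\<close> the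
  recursion stops at once, since the weight need not decrease there.
\<close>

function normal_form :: "nat \<Rightarrow> monomial \<Rightarrow> xpoly" where
  "normal_form N m =
    (if bounded_by N m \<and> (\<exists>i j k. contains_product m i j k)
     then case leftmost_factorization m of (i, j, k, r) \<Rightarrow>
       normal_form N (expo i k + expo i j + r) + normal_form N (expo j k + expo i k + r)
       + xterm \<beta> 0 * normal_form N (expo i k + r)
     else xterm 1 m)"
  by pat_completeness auto

lemma leftmost_factorizationE:
  assumes "\<exists>i j k. contains_product m i j k"
  obtains i j k r where "leftmost_factorization m = (i, j, k, r)" "m = expo i j + expo j k + r"
    "leftmost_product m i j k" "i < j" "j < k"
proof -
  from assms leftmost_product_exists obtain i j k where l: "leftmost_product m i j k" by blast
  then obtain r where m: "m = expo i j + expo j k + r" and "i < j" "j < k"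
    unfolding leftmost_product_def contains_product_def by blast
  with leftmost_factorization_eq[of i j k r] l that show ?thesis by blast
qed

termination normal_form
proof (relation "measure (\<lambda>(N, m). weight N m)", goal_cases)
  case 1 show ?case by simp
next
  case (2 N m)
  then have c: "bounded_by N m" "\<exists>i j k. contains_product m i j k" by auto
  from leftmost_factorizationE[OF c(2)] obtain i' j' k' r' where
    "leftmost_factorization m = (i', j', k', r')" "m = expo i' j' + expo j' k' + r'" "i' < j'" "j' < k'"
    by metis
  with 2 c(1) replacement_decreases_weight(1)[of N i' j' k' r'] show ?case by auto
next
  case (3 N m)
  then have c: "bounded_by N m" "\<exists>i j k. contains_product m i j k" by auto
  from leftmost_factorizationE[OF c(2)] obtain i' j' k' r' where
    "leftmost_factorization m = (i', j', k', r')" "m = expo i' j' + expo j' k' + r'" "i' < j'" "j' < k'"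
    by metis
  with 3 c(1) replacement_decreases_weight(2)[of N i' j' k' r'] show ?case by auto
next
  case (4 N m)
  then have c: "bounded_by N m" "\<exists>i j k. contains_product m i j k" by auto
  from leftmost_factorizationE[OF c(2)] obtain i' j' k' r' where
    "leftmost_factorization m = (i', j', k', r')" "m = expo i' j' + expo j' k' + r'" "i' < j'" "j' < k'"
    by metis
  with 4 c(1) replacement_decreases_weight(3)[of N i' j' k' r'] show ?case by auto
qed

declare normal_form.simps [simp del]

lemma normal_form_irreducible:
  "\<nexists>i j k. contains_product m i j k \<Longrightarrow> normal_form N m = xterm 1 m"
  by (subst normal_form.simps, subst if_not_P) blast+

lemma normal_form_step:
  assumes "bounded_by N (expo i j + expo j k + r)" "leftmost_product (expo i j + expo j k + r) i j k"
  shows "normal_form N (expo i j + expo j k + r) =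
      normal_form N (expo i k + expo i j + r) + normal_form N (expo j k + expo i k + r)
      + xterm \<beta> 0 * normal_form N (expo i k + r)"
proof -
  have "\<exists>i' j' k'. contains_product (expo i j + expo j k + r) i' j' k'"
    using assms(2) unfolding leftmost_product_def by blast
  with assms(1) show ?thesis
    by (subst normal_form.simps) (simp add: leftmost_factorization_eq[OF assms(2)])
qed

text \<open>
  The \<open>\<int>[\<beta>]\<close>-linear extension of \<open>F\<close> from monomials to polynomials; \<open>xterm c 0\<close> is the constant \<open>c\<close>.
\<close>

definition extend :: "(monomial \<Rightarrow> xpoly) \<Rightarrow> xpoly \<Rightarrow> xpoly" where
  "extend F p = (\<Sum>m\<in>Poly_Mapping.keys p. xterm (Poly_Mapping.lookup p m) 0 * F m)"

lemma extend_superset: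
  assumes "finite A" "Poly_Mapping.keys p \<subseteq> A"
  shows "extend F p = (\<Sum>m\<in>A. xterm (Poly_Mapping.lookup p m) 0 * F m)"
  unfolding extend_def
  by (rule sum.mono_neutral_left) (use assms in \<open>auto simp: in_keys_iff xterm_def\<close>)

lemma extend_add: "extend F (p + q) = extend F p + extend F q"
proof -
  let ?A = "Poly_Mapping.keys p \<union> Poly_Mapping.keys q"
  have "extend F (p + q) = (\<Sum>m\<in>?A. xterm (Poly_Mapping.lookup (p + q) m) 0 * F m)"
    by (rule extend_superset) (use Poly_Mapping.keys_add[of p q] in auto)
  also have "\<dots> = extend F p + extend F q"
    using extend_superset[of ?A p F] extend_superset[of ?A q F]
    by (simp add: lookup_add xterm_add sum.distrib algebra_simps)
  finally show ?thesis .
qed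

lemma extend_diff: "extend F (p - q) = extend F p - extend F q"
  using extend_add[of F "p - q" q] by simp

lemma extend_xterm: "extend F (xterm c m) = xterm c 0 * F m"
  using extend_superset[of "{m}" "xterm c m" F] by (simp add: xterm_def)

text \<open>
  This invariant determines the outcome of every sequence of replacements: linearity turns
  the recursion for \<open>normal_form\<close> into invariance under replacing one term, whatever
  cancellations occur between the terms of the polynomial.
\<close>

lemma extend_normal_form_replacement:
  assumes "replacement p q" "\<forall>m\<in>Poly_Mapping.keys p. bounded_by N m"
  shows "extend (normal_form N) q = extend (normal_form N) p"
  using assms
proof (cases rule: replacement.cases)
  case (1 i j k m c)
  have "bounded_by N (expo i j + expo j k + m)" using 1 assms(2) by blast
  note step = normal_form_step[OF this 1(3)]
  show ?thesis
    unfolding 1(1) replacement_result by (simp only: extend_add extend_diff extend_xterm step)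
      (simp add: algebra_simps flip: xterm_mult[of c 0 \<beta> 0, simplified])
qed

text \<open>
  A replacement subtracts the whole coefficient of the replaced monomial, so this monomial leaves the
  support; the new monomials may already be present, or cancel.
\<close>

lemma keys_replacement:
  assumes "c = Poly_Mapping.lookup p (expo i j + expo j k + m)"
  shows "Poly_Mapping.keys (p - xterm c (expo i j + expo j k + m)
           + xterm c m * (X i k * X i j + X j k * X i k + xterm \<beta> 0 * X i k))
    \<subseteq> (Poly_Mapping.keys p - {expo i j + expo j k + m}) \<union>
      {expo i k + expo i j + m, expo j k + expo i k + m, expo i k + m}"
proof -
  have "Poly_Mapping.keys (p - xterm c (expo i j + expo j k + m)) \<subseteq>
      Poly_Mapping.keys p - {expo i j + expo j k + m}"
    using assms(1) by (auto simp: in_keys_iff xterm_def lookup_minus lookup_single when_def split: if_splits)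
  moreover have "Poly_Mapping.keys (xterm c m * (X i k * X i j + X j k * X i k + xterm \<beta> 0 * X i k))
      \<subseteq> {expo i k + expo i j + m, expo j k + expo i k + m, expo i k + m}"
    unfolding replacement_result
    by (intro order.trans[OF Poly_Mapping.keys_add] Un_least order.trans[OF keys_xterm]) auto
  ultimately show ?thesis
    by (intro order.trans[OF Poly_Mapping.keys_add]) blast
qed

lemma replacement_bounded:
  assumes "replacement p q" "\<forall>m\<in>Poly_Mapping.keys p. bounded_by N m"
  shows "\<forall>m\<in>Poly_Mapping.keys q. bounded_by N m"
  using assms(1)
proof (cases rule: replacement.cases)
  case (1 i j k m c)
  note K = keys_replacement[OF 1(4), folded 1(1)]
  have "bounded_by N (expo i j + expo j k + m)" using 1 assms(2) by blast
  then show ?thesis using K assms(2) by fastforce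
qed

lemma replacements_invariant:
  assumes "replacement\<^sup>*\<^sup>* p q" "\<forall>m\<in>Poly_Mapping.keys p. bounded_by N m"
  shows "(\<forall>m\<in>Poly_Mapping.keys q. bounded_by N m) \<and>
    extend (normal_form N) q = extend (normal_form N) p"
  using assms(1)
proof (induction rule: rtranclp_induct)
  case base
  show ?case using assms(2) by simp
next
  case (step q r)
  then show ?case
    using replacement_bounded[of q r N] extend_normal_form_replacement[of q r N] by metis
qed

lemma extend_monomials: "extend (xterm 1) p = p"
proof (rule poly_mapping_eqI)
  fix m
  have "Poly_Mapping.lookup (extend (xterm 1) p) m =
      (\<Sum>m'\<in>Poly_Mapping.keys p. if m' = m then Poly_Mapping.lookup p m else 0)"
    unfolding extend_def lookup_sum
    by (rule sum.cong) (auto simp: xterm_def mult_single lookup_single when_def)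
  then show "Poly_Mapping.lookup (extend (xterm 1) p) m = Poly_Mapping.lookup p m"
    by (simp add: in_keys_iff)
qed

lemma extend_normal_form_reduced:
  assumes "reduced p" shows "extend (normal_form N) p = p"
proof -
  have "extend (normal_form N) p = extend (xterm 1) p"
    unfolding extend_def
    by (rule sum.cong) (use assms in \<open>auto simp: reduced_def normal_form_irreducible\<close>)
  then show ?thesis by (simp add: extend_monomials)
qed

text \<open>
  Each replacement trades one monomial for at most three of smaller weight. Giving a monomial of
  weight \<open>w\<close> the value \<open>4\<^sup>w\<close> makes the total value of the support decrease, because \<open>3 < 4\<close>.
\<close>

lemma reduction_exists:
  assumes "\<forall>m\<in>Poly_Mapping.keys p. bounded_by N m"
  shows "\<exists>q. replacement\<^sup>*\<^sup>* p q \<and> reduced q"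
  using assms
proof (induction "\<Sum>m\<in>Poly_Mapping.keys p. 4 ^ weight N m :: nat" arbitrary: p rule: less_induct)
  case less
  show ?case
  proof (cases "reduced p")
    case False
    then obtain m where m: "m \<in> Poly_Mapping.keys p" "\<exists>i j k. contains_product m i j k"
      unfolding reduced_def by blast
    from leftmost_factorizationE[OF m(2)] obtain i j k r where
      mr: "m = expo i j + expo j k + r" and l: "leftmost_product m i j k" and ijk: "i < j" "j < k"
      by metis
    define c where "c = Poly_Mapping.lookup p m"
    define q where "q = p - xterm c m
           + xterm c r * (X i k * X i j + X j k * X i k + xterm \<beta> 0 * X i k)"
    have step: "replacement p q"
      unfolding q_def mr by (rule replacement.intros) (use m l mr c_def in auto)
    have "bounded_by N m" using less.prems m by blast
    note w = replacement_decreases_weight[OF this[unfolded mr] ijk, folded mr]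
    let ?w = "\<lambda>m. 4 ^ weight N m :: nat"
    let ?T = "[expo i k + expo i j + r, expo j k + expo i k + r, expo i k + r]"
    have small: "4 * ?w m' \<le> ?w m" if "m' \<in> set ?T" for m'
    proof -
      have "Suc (weight N m') \<le> weight N m" using that w by auto
      then have "4 ^ Suc (weight N m') \<le> ?w m" by (intro power_increasing) auto
      then show ?thesis by simp
    qed
    have "sum ?w (set ?T) \<le> sum_list (map ?w ?T)"
      by (simp add: sum.insert_if del: weight_add)
    also have "\<dots> < ?w m"
    proof -
      have "a + (b + c) < e" if "4 * a \<le> e" "4 * b \<le> e" "4 * c \<le> e" "0 < e" for a b c e :: nat
        using that by linarith
      from this[OF small[of "?T ! 0"] small[of "?T ! 1"] small[of "?T ! 2"]] show ?thesis
        by (simp del: weight_add)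
    qed
    finally have T: "sum ?w (set ?T) < ?w m" .
    have "Poly_Mapping.keys q \<subseteq> (Poly_Mapping.keys p - {m}) \<union> set ?T"
      using keys_replacement[of c p i j k r] by (simp add: q_def mr c_def)
    then have "sum ?w (Poly_Mapping.keys q) \<le> sum ?w ((Poly_Mapping.keys p - {m}) \<union> set ?T)"
      by (intro sum_mono2) auto
    also have "\<dots> \<le> sum ?w (Poly_Mapping.keys p - {m}) + sum ?w (set ?T)"
      by (subst sum_Un_nat) auto
    also have "\<dots> < sum ?w (Poly_Mapping.keys p - {m}) + ?w m"
      using T by simp
    also have "\<dots> = sum ?w (Poly_Mapping.keys p)"
      using m(1) by (subst sum.remove[of _ m]) auto
    finally have "\<exists>q'. replacement\<^sup>*\<^sup>* q q' \<and> reduced q'"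
      using less.hyps replacement_bounded[OF step less.prems] by blast
    with step show ?thesis by (meson converse_rtranclp_into_rtranclp)
  qed blast
qed

text \<open>
  Existence and uniqueness together resolve the definite description: a reduced polynomial equals
  its own normal form, and by invariance that is the normal form of \<open>p\<close>.
\<close>

theorem reduced_polynomial_eq:
  assumes "\<forall>m\<in>Poly_Mapping.keys p. bounded_by N m"
  shows "reduced_polynomial p = extend (normal_form N) p"
  unfolding reduced_polynomial_def
proof (rule the1_equality')
  show "\<exists>\<^sub>\<le>\<^sub>1q. replacement\<^sup>*\<^sup>* p q \<and> reduced q"
    by (rule Uniq_I) (metis assms replacements_invariant extend_normal_form_reduced)
  show "replacement\<^sup>*\<^sup>* p (extend (normal_form N) p) \<and> reduced (extend (normal_form N) p)"
    using reduction_exists[OF assms] by (metis assms replacements_invariant extend_normal_form_reduced)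
qed

section \<open>Reductions as binary trees\<close>

abbreviation coeff_sum :: "xpoly \<Rightarrow> int poly" where
  "coeff_sum \<equiv> xeval (\<lambda>_. 1)"

lemma coeff_sum_add: "coeff_sum (p + q) = coeff_sum p + coeff_sum q"
  using Poly_Mapping.setsum_keys_plus_distrib[of "\<lambda>_ c. c" p q]
  by (simp add: xeval_def)

lemma coeff_sum_xterm: "coeff_sum (xterm c m) = c"
  by (cases "c = 0") (simp_all add: xeval_def xterm_def)

lemma coeff_sum_scale: "coeff_sum (xterm c 0 * p) = c * coeff_sum p"
proof -
  have "xterm c 0 * p = Poly_Mapping.map ((*) c) p"
    by (simp add: xterm_def mult_map_scale_conv_mult)
  then have l: "Poly_Mapping.lookup (xterm c 0 * p) m = c * Poly_Mapping.lookup p m" for m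
    by (simp add: Poly_Mapping.map.rep_eq when_def)
  have "coeff_sum (xterm c 0 * p) = (\<Sum>m\<in>Poly_Mapping.keys p. c * Poly_Mapping.lookup p m)"
    unfolding xeval_def power_one prod.neutral_const mult_1_right l
    by (rule sum.mono_neutral_left) (auto simp: in_keys_iff l)
  then show ?thesis by (simp add: xeval_def sum_distrib_left)
qed

text \<open>
  At \<open>\<beta> = 0\<close> the reduction of a monomial is a binary tree, and the sum of the coefficients of the
  normal form is the number of its leaves.
\<close>

definition leaves :: "nat \<Rightarrow> monomial \<Rightarrow> int" where
  "leaves N m = poly (coeff_sum (normal_form N m)) 0"

lemma leaves_irreducible: "\<nexists>i j k. contains_product m i j k \<Longrightarrow> leaves N m = 1"
  by (simp add: leaves_def normal_form_irreducible coeff_sum_xterm)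

lemma leaves_step:
  assumes "bounded_by N (expo i j + expo j k + r)" "leftmost_product (expo i j + expo j k + r) i j k"
  shows "leaves N (expo i j + expo j k + r) =
    leaves N (expo i k + expo i j + r) + leaves N (expo j k + expo i k + r)"
  unfolding leaves_def normal_form_step[OF assms]
  by (simp add: coeff_sum_add coeff_sum_scale \<beta>_def)

lemma P_monomial_at_zero:
  assumes "bounded_by N m" shows "poly (P (xterm 1 m)) 0 = leaves N m"
proof -
  have "P (xterm 1 m) = coeff_sum (normal_form N m)"
    unfolding P_def
    by (subst reduced_polynomial_eq[of _ N])
      (use assms keys_xterm in \<open>auto simp: extend_xterm coeff_sum_scale\<close>)
  then show ?thesis by (simp add: leaves_def)
qed

section \<open>The monomials in variables with indices up to 4\<close>

text \<open>
  The exponents belong to \<open>x\<^bsub>12\<^esub>, x\<^bsub>13\<^esub>, x\<^bsub>14\<^esub>, x\<^bsub>23\<^esub>, x\<^bsub>24\<^esub>, x\<^bsub>34\<^esub>\<close> in lexicographic order.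
\<close>

definition mono4 :: "nat \<Rightarrow> nat \<Rightarrow> nat \<Rightarrow> nat \<Rightarrow> nat \<Rightarrow> nat \<Rightarrow> monomial" where
  "mono4 a b c d e g = Poly_Mapping.single (1, 2) a + Poly_Mapping.single (1, 3) b +
     Poly_Mapping.single (1, 4) c + Poly_Mapping.single (2, 3) d +
     Poly_Mapping.single (2, 4) e + Poly_Mapping.single (3, 4) g"

lemma bounded_mono4: "bounded_by 4 (mono4 a b c d e g)"
  by (auto simp: mono4_def bounded_by_iff lookup_add lookup_single when_def split: if_splits)

lemma contains_product_iff:
  "contains_product m i j k \<longleftrightarrow> i < j \<and> j < k \<and>
     Poly_Mapping.lookup m (i, j) > 0 \<and> Poly_Mapping.lookup m (j, k) > 0"
proof
  assume "i < j \<and> j < k \<and> Poly_Mapping.lookup m (i, j) > 0 \<and> Poly_Mapping.lookup m (j, k) > 0"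
  then have "m = expo i j + expo j k + (m - expo i j - expo j k)" "i < j" "j < k"
    by (auto intro!: poly_mapping_eqI simp: lookup_add lookup_minus expo_def lookup_single when_def)
  then show "contains_product m i j k" unfolding contains_product_def by blast
qed (auto simp: contains_product_def lookup_add expo_def)

lemma lookup_mono4:
  "Poly_Mapping.lookup (mono4 a b c d e g) (i, j) =
    (if (i, j) = (1, 2) then a else if (i, j) = (1, 3) then b else if (i, j) = (1, 4) then c
     else if (i, j) = (2, 3) then d else if (i, j) = (2, 4) then e
     else if (i, j) = (3, 4) then g else 0)"
  by (simp add: mono4_def lookup_add lookup_single when_def)

lemma contains_product_mono4:
  "contains_product (mono4 a b c d e g) i j k \<longleftrightarrow>
    (i, j, k) = (1, 2, 3) \<and> a > 0 \<and> d > 0 \<or> (i, j, k) = (1, 2, 4) \<and> a > 0 \<and> e > 0 \<or>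
    (i, j, k) = (1, 3, 4) \<and> b > 0 \<and> g > 0 \<or> (i, j, k) = (2, 3, 4) \<and> d > 0 \<and> g > 0"
  unfolding contains_product_iff lookup_mono4 by auto

lemma mono4_123: "mono4 (Suc a) b c (Suc d) e g = expo 1 2 + expo 2 3 + mono4 a b c d e g"
  "expo 1 3 + expo 1 2 + mono4 a b c d e g = mono4 (Suc a) (Suc b) c d e g"
  "expo 2 3 + expo 1 3 + mono4 a b c d e g = mono4 a (Suc b) c (Suc d) e g"
  by (auto intro!: poly_mapping_eqI simp: lookup_add mono4_def expo_def lookup_single when_def)

lemma mono4_134: "mono4 a (Suc b) c d e (Suc g) = expo 1 3 + expo 3 4 + mono4 a b c d e g"
  "expo 1 4 + expo 1 3 + mono4 a b c d e g = mono4 a (Suc b) (Suc c) d e g"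
  "expo 3 4 + expo 1 4 + mono4 a b c d e g = mono4 a b (Suc c) d e (Suc g)"
  by (auto intro!: poly_mapping_eqI simp: lookup_add mono4_def expo_def lookup_single when_def)

lemma mono4_234: "mono4 a b c (Suc d) e (Suc g) = expo 2 3 + expo 3 4 + mono4 a b c d e g"
  "expo 2 4 + expo 2 3 + mono4 a b c d e g = mono4 a b c (Suc d) (Suc e) g"
  "expo 3 4 + expo 2 4 + mono4 a b c d e g = mono4 a b c d (Suc e) (Suc g)"
  by (auto intro!: poly_mapping_eqI simp: lookup_add mono4_def expo_def lookup_single when_def)

text \<open>
  The products are used up in the order \<open>x\<^bsub>12\<^esub>x\<^bsub>23\<^esub>\<close>, \<open>x\<^bsub>13\<^esub>x\<^bsub>34\<^esub>\<close>, \<open>x\<^bsub>23\<^esub>x\<^bsub>34\<^esub>\<close>. The product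
  \<open>x\<^bsub>12\<^esub>x\<^bsub>24\<^esub>\<close> does not arise: \<open>x\<^bsub>24\<^esub>\<close> is created only from \<open>x\<^bsub>23\<^esub>\<close>, and at that time \<open>x\<^bsub>12\<^esub>\<close> is
  exhausted. The side condition of the second rule says that neither product with \<open>x\<^bsub>12\<^esub>\<close> is present.
\<close>

lemma leaves_mono4_step:
  shows leaves_123: "leaves 4 (mono4 (Suc a) b c (Suc d) e g) =
      leaves 4 (mono4 (Suc a) (Suc b) c d e g) + leaves 4 (mono4 a (Suc b) c (Suc d) e g)"
    and leaves_134: "(a = 0 \<or> d = 0 \<and> e = 0) \<Longrightarrow> leaves 4 (mono4 a (Suc b) c d e (Suc g)) =
      leaves 4 (mono4 a (Suc b) (Suc c) d e g) + leaves 4 (mono4 a b (Suc c) d e (Suc g))"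
    and leaves_234: "leaves 4 (mono4 0 0 c (Suc d) e (Suc g)) =
      leaves 4 (mono4 0 0 c (Suc d) (Suc e) g) + leaves 4 (mono4 0 0 c d (Suc e) (Suc g))"
proof -
  have "leftmost_product (mono4 (Suc a) b c (Suc d) e g) 1 2 3"
    by (auto simp: leftmost_product_def contains_product_mono4)
  then show "leaves 4 (mono4 (Suc a) b c (Suc d) e g) =
      leaves 4 (mono4 (Suc a) (Suc b) c d e g) + leaves 4 (mono4 a (Suc b) c (Suc d) e g)"
    using leaves_step[of 4 1 2 3 "mono4 a b c d e g"]
      bounded_mono4[of "Suc a" b c "Suc d" e g]
    unfolding mono4_123 by blast
next
  assume "a = 0 \<or> d = 0 \<and> e = 0"
  then have "leftmost_product (mono4 a (Suc b) c d e (Suc g)) 1 3 4"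
    by (auto simp: leftmost_product_def contains_product_mono4)
  then show "leaves 4 (mono4 a (Suc b) c d e (Suc g)) =
      leaves 4 (mono4 a (Suc b) (Suc c) d e g) + leaves 4 (mono4 a b (Suc c) d e (Suc g))"
    using leaves_step[of 4 1 3 4 "mono4 a b c d e g"]
      bounded_mono4[of a "Suc b" c d e "Suc g"]
    unfolding mono4_134 by blast
next
  have "leftmost_product (mono4 0 0 c (Suc d) e (Suc g)) 2 3 4"
    by (auto simp: leftmost_product_def contains_product_mono4)
  then show "leaves 4 (mono4 0 0 c (Suc d) e (Suc g)) =
      leaves 4 (mono4 0 0 c (Suc d) (Suc e) g) + leaves 4 (mono4 0 0 c d (Suc e) (Suc g))"
    using leaves_step[of 4 2 3 4 "mono4 0 0 c d e g"]
      bounded_mono4[of 0 0 c "Suc d" e "Suc g"]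
    unfolding mono4_234 by blast
qed

text \<open>
  Without \<open>x\<^bsub>12\<^esub>\<close> each replacement removes one \<open>x\<^bsub>34\<^esub>\<close> or one of the \<open>b + d\<close> variables \<open>x\<^bsub>13\<^esub>, x\<^bsub>23\<^esub>\<close>,
  the \<open>x\<^bsub>13\<^esub>\<close> being removed first. So the leaves are lattice paths from \<open>(b + d, g)\<close> to the
  coordinate axes, counted by Pascal's rule.
\<close>

lemma leaves_no_x12: "leaves 4 (mono4 0 b c d e g) = int ((b + d + g) choose g)"
proof (induction "b + d + g" arbitrary: b c d e g rule: less_induct)
  case less
  show ?case
  proof (cases g)
    case 0
    then show ?thesis by (simp add: leaves_irreducible contains_product_mono4)
  next
    case (Suc g')
    consider (b) b' where "b = Suc b'" | (d) d' where "b = 0" "d = Suc d'" | (z) "b = 0" "d = 0"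
      by (meson not0_implies_Suc)
    then show ?thesis
    proof cases
      case b
      with Suc show ?thesis by (simp add: leaves_134 less)
    next
      case d
      with Suc show ?thesis by (simp add: leaves_234 less)
    next
      case z
      then show ?thesis by (simp add: leaves_irreducible contains_product_mono4)
    qed
  qed
qed

text \<open>
  When \<open>x\<^bsub>23\<^esub>\<close> is exhausted first, the remaining \<open>x\<^bsub>12\<^esub>\<close> are inert, and only \<open>x\<^bsub>13\<^esub>\<close> and \<open>x\<^bsub>34\<^esub>\<close> are
  consumed.
\<close>

lemma leaves_no_x23: "leaves 4 (mono4 a b c 0 0 g) = int ((b + g) choose g)"
proof (induction "b + g" arbitrary: b c g rule: less_induct)
  case less
  show ?case
  proof (cases "b = 0 \<or> g = 0")
    case True
    then show ?thesis by (auto simp: leaves_irreducible contains_product_mono4)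
  next
    case False
    then obtain b' g' where "b = Suc b'" "g = Suc g'" by (meson not0_implies_Suc)
    then show ?thesis by (simp add: leaves_134 less)
  qed
qed

lemma xterm_power: "xterm 1 (Poly_Mapping.single e a) ^ n = xterm 1 (Poly_Mapping.single e (n * a))"
  by (induction n) (simp_all add: xterm_mult one_xterm flip: single_add)

lemma start_monomial: "(X 1 2 * X 2 3) ^ n * X 3 4 ^ k = xterm 1 (mono4 n 0 0 n 0 k)"
  unfolding power_mult_distrib X_def expo_def xterm_power
  by (simp add: xterm_mult mono4_def)

section \<open>A recursion for up, down, up words\<close>

text \<open>
  For \<open>t = a + d + g + 1\<close> this is the number of arrangements of \<open>t\<close> values with \<open>a\<close> ascents, then
  \<open>d\<close> descents, then \<open>g\<close> ascents. The second equation reads: if the step after the descents is left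
  free, the word is a peak on \<open>a + d + 1\<close> of the values followed by an increasing word, and
  \<open>t choose Suc g\<close> counts the value sets of the latter; if the free step goes down, there is one more
  descent and one fewer final ascent. Keeping \<open>t\<close> as a parameter of its own makes the Pascal rule
  below meaningful: it changes \<open>a + d\<close> but not \<open>t\<close>.
\<close>

fun ribbon :: "nat \<Rightarrow> nat \<Rightarrow> nat \<Rightarrow> nat \<Rightarrow> int" where
  "ribbon t a d 0 = int ((a + d) choose a)"
| "ribbon t a d (Suc g) = int ((t choose Suc g) * ((a + d) choose a)) - ribbon t a (Suc d) g"

text \<open>
  Unfolding the recursion gives \<open>\<Sum>j\<le>g. (-1)\<^sup>j (t choose (g - j)) ((a + d + j) choose a)\<close>, in which
  every summand satisfies Pascal's rule in \<open>a\<close> and \<open>d\<close>.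
\<close>

lemma ribbon_pascal:
  "ribbon t (Suc a) (Suc d) g = ribbon t (Suc a) d g + ribbon t a (Suc d) g"
  by (induction g arbitrary: d) (simp_all add: algebra_simps)

lemma ribbon_no_ascent: "t > 0 \<Longrightarrow> ribbon t 0 d g = int ((t - 1) choose g)"
  by (induction g arbitrary: d) (auto simp: gr0_conv_Suc)

lemma ribbon_no_descent: "a < t \<Longrightarrow> ribbon t a 0 g = int ((t - 1 - a) choose g)"
proof (induction g arbitrary: a)
  case (Suc g)
  \<comment> \<open>By Pascal's rule the value at one descent telescopes along the hockey stick
    \<open>\<Sum>i\<le>a. (t - 1 - i) choose g\<close>.\<close>
  have "ribbon t a (Suc 0) g = int (t choose Suc g) - int ((t - 1 - a) choose Suc g)"
    using \<open>a < t\<close>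
  proof (induction a)
    case 0
    then show ?case by (auto simp: ribbon_no_ascent gr0_conv_Suc)
  next
    case step: (Suc a)
    then obtain s where "t - 1 - a = Suc s" "t - Suc (Suc a) = s"
      by (metis Suc_diff_Suc diff_Suc_eq_diff_pred)
    with step show ?case by (simp add: ribbon_pascal Suc.IH)
  qed
  then show ?case by simp
qed simp

text \<open>
  Replacing \<open>x\<^bsub>12\<^esub>x\<^bsub>23\<^esub>\<close> keeps \<open>a + b + d\<close> fixed and lowers \<open>a\<close> or \<open>d\<close> by one, which is Pascal's rule
  for \<open>ribbon\<close> with the same \<open>t\<close>. The two boundaries, where \<open>x\<^bsub>12\<^esub>\<close> or \<open>x\<^bsub>23\<^esub>\<close> is exhausted, are the two
  binomial coefficients found above.
\<close>

lemma leaves_ribbon: "leaves 4 (mono4 a b c d 0 g) = ribbon (a + b + d + 1 + g) a d g"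
proof (induction "a + d" arbitrary: a b c d rule: less_induct)
  case less
  show ?case
  proof (cases a)
    case 0
    then show ?thesis by (simp add: leaves_no_x12 ribbon_no_ascent)
  next
    case a: (Suc a')
    show ?thesis
    proof (cases d)
      case 0
      then show ?thesis by (simp add: leaves_no_x23 ribbon_no_descent)
    next
      case d: (Suc d')
      show ?thesis unfolding a d leaves_123 ribbon_pascal
        using less[of a "d'" "Suc b" c] less[of a' d "Suc b" c] by (simp add: a d)
    qed
  qed
qed

section \<open>Counting up, down, up words\<close>

text \<open>
  The two sets differ in the last condition only: in \<open>peaks\<close> the step after the \<open>d\<close> descents is free,
  in \<open>words\<close> it is an ascent. The entry with (zero-based) position \<open>a\<close> is the peak, the one with
  position \<open>a + d\<close> is the valley.
\<close>

definition peaks :: "nat set \<Rightarrow> nat \<Rightarrow> nat \<Rightarrow> nat list set" where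
  "peaks S a d = {xs \<in> permutations_of_set S.
     sorted_wrt (<) (take (Suc a) xs) \<and> sorted_wrt (>) (take (Suc d) (drop a xs)) \<and>
     sorted_wrt (<) (drop (Suc (a + d)) xs)}"

definition words :: "nat set \<Rightarrow> nat \<Rightarrow> nat \<Rightarrow> nat list set" where
  "words S a d = {xs \<in> permutations_of_set S.
     sorted_wrt (<) (take (Suc a) xs) \<and> sorted_wrt (>) (take (Suc d) (drop a xs)) \<and>
     sorted_wrt (<) (drop (a + d) xs)}"

text \<open>
  The element of \<open>peaks\<close> with final block \<open>T\<close> and initial block \<open>U\<close>.
\<close>

definition peak_word :: "nat set \<Rightarrow> nat set \<Rightarrow> nat set \<Rightarrow> nat list" where
  "peak_word S T U = sorted_list_of_set U @ Max (S - T) #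
     rev (sorted_list_of_set (S - T - {Max (S - T)} - U)) @ sorted_list_of_set T"

lemma sorted_list_of_set_eq: "sorted_wrt (<) xs \<Longrightarrow> sorted_list_of_set (set xs) = xs"
  by (rule strict_sorted_equal) simp_all

text \<open>
  The set \<open>T\<close> of the last \<open>k\<close> values is arbitrary. The peak is then the largest remaining value, and the
  set \<open>U\<close> of the first \<open>a\<close> values is an arbitrary subset of the \<open>a + d\<close> values other than these. As all
  blocks are sorted, \<open>T\<close> and \<open>U\<close> determine the word.
\<close>

lemma card_peaks:
  assumes S: "finite S" "card S = a + d + 1 + k"
  shows "card (peaks S a d) = (card S choose k) * ((a + d) choose a)"
proof -
  let ?M = "\<lambda>T. Max (S - T)"
  define B where "B = (SIGMA T:{T. T \<subseteq> S \<and> card T = k}. {U. U \<subseteq> S - T - {?M T} \<and> card U = a})"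
  define f where "f xs = (set (drop (Suc (a + d)) xs), set (take a xs))" for xs :: "nat list"
  have M: "?M T \<in> S - T" "\<And>x. x \<in> S - T \<Longrightarrow> x \<le> ?M T" "card (S - T - {?M T}) = a + d"
    if "T \<subseteq> S" "card T = k" for T
  proof -
    have c: "card (S - T) = Suc (a + d)"
      using that S by (simp add: card_Diff_subset finite_subset)
    then have "S - T \<noteq> {}" by (metis card.empty nat.distinct(1))
    then show "?M T \<in> S - T" "\<And>x. x \<in> S - T \<Longrightarrow> x \<le> ?M T"
      using S by (auto intro: Max_in Max_ge simp del: Diff_iff)
    then show "card (S - T - {?M T}) = a + d"
      using c S by (subst card_Diff_singleton) auto
  qed
  have to_word: "peak_word S T U \<in> peaks S a d \<and> f (peak_word S T U) = (T, U)"
    if "T \<subseteq> S" "card T = k" "U \<subseteq> S - T - {?M T}" "card U = a" for T U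
  proof -
    note M = M[OF that(1,2)]
    let ?R = "S - T - {?M T} - U"
    have fin: "finite T" "finite U" "finite ?R" using that S by (auto intro: finite_subset)
    have "card ?R = d" using that M S fin by (simp add: card_Diff_subset)
    then have len: "length (sorted_list_of_set U) = a" "length (sorted_list_of_set ?R) = d"
      using that by simp_all
    have less: "x < ?M T" if "x \<in> S - T - {?M T}" for x
      using M(2)[of x] that by force
    have "set (peak_word S T U) = S"
      using fin that M(1) by (auto simp: peak_word_def)
    moreover have "distinct (peak_word S T U)"
      using fin that M(1) by (auto simp: peak_word_def)
    moreover have "sorted_wrt (<) (take (Suc a) (peak_word S T U))"
      using len fin that less by (auto simp: peak_word_def sorted_wrt_append)
    moreover have "sorted_wrt (>) (take (Suc d) (drop a (peak_word S T U)))"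
      using len fin that less by (auto simp: peak_word_def sorted_wrt_rev)
    moreover have drop: "drop (Suc (a + d)) (peak_word S T U) = sorted_list_of_set T"
      using len by (simp add: peak_word_def)
    ultimately have "peak_word S T U \<in> peaks S a d"
      by (simp add: peaks_def permutations_of_set_def)
    moreover have "take a (peak_word S T U) = sorted_list_of_set U"
      using len by (simp add: peak_word_def)
    ultimately show ?thesis using fin by (simp add: f_def drop)
  qed
  have from_word: "f xs \<in> B \<and> (\<lambda>(T, U). peak_word S T U) (f xs) = xs" if "xs \<in> peaks S a d" for xs
  proof -
    from that have xs: "set xs = S" "distinct xs" and s: "sorted_wrt (<) (take (Suc a) xs)"
      "sorted_wrt (>) (take (Suc d) (drop a xs))" "sorted_wrt (<) (drop (Suc (a + d)) xs)"
      by (auto simp: peaks_def permutations_of_set_def)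
    have len: "length xs = a + d + 1 + k" using xs S by (metis distinct_card)
    define us v ws ts where "us = take a xs" and "v = xs ! a" and "ws = take d (drop (Suc a) xs)"
      and "ts = drop (Suc (a + d)) xs"
    have dr: "drop a xs = v # drop (Suc a) xs"
      using len by (simp add: v_def Cons_nth_drop_Suc)
    have uv: "take (Suc a) xs = us @ [v]"
      using len by (simp add: us_def v_def take_Suc_conv_app_nth)
    have vw: "take (Suc d) (drop a xs) = v # ws" by (simp add: dr ws_def)
    have dec: "xs = us @ v # ws @ ts"
    proof -
      have "drop (Suc a) xs = ws @ ts"
        unfolding ws_def ts_def by (metis add.commute add_Suc_right append_take_drop_id drop_drop)
      then show ?thesis by (metis append_take_drop_id dr us_def)
    qed
    have srt: "sorted_wrt (<) us" "\<forall>x\<in>set us. x < v" "sorted_wrt (>) ws" "\<forall>x\<in>set ws. x < v"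
      "sorted_wrt (<) ts"
      using s by (simp_all add: uv vw sorted_wrt_append flip: ts_def)
    have dis: "distinct (us @ v # ws @ ts)" and st: "set (us @ v # ws @ ts) = S"
      using xs dec by auto
    have ST: "S - set ts = insert v (set us \<union> set ws)"
      using dis unfolding st[symmetric] by auto
    have Mv: "?M (set ts) = v"
      unfolding ST by (rule Max_eqI) (use srt in \<open>auto intro: less_imp_le\<close>)
    have R: "S - set ts - {v} - set us = set (rev ws)"
      unfolding ST using dis by auto
    have "sorted_list_of_set (set (rev ws)) = rev ws"
      by (rule sorted_list_of_set_eq) (use srt in \<open>simp add: sorted_wrt_rev\<close>)
    then have "peak_word S (set ts) (set us) = xs"
      unfolding peak_word_def Mv R using srt by (simp add: sorted_list_of_set_eq dec)
    moreover have "card (set ts) = k" "card (set us) = a"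
      using dis len by (simp_all add: distinct_card us_def ts_def)
    moreover have "set ts \<subseteq> S" "set us \<subseteq> S - set ts - {v}"
      using dis st by auto
    ultimately show ?thesis
      by (simp add: f_def B_def Mv flip: us_def ts_def)
  qed
  have "bij_betw f (peaks S a d) B"
  proof (rule bij_betw_byWitness[where f' = "\<lambda>(T, U). peak_word S T U"])
    show "\<forall>xs\<in>peaks S a d. (\<lambda>(T, U). peak_word S T U) (f xs) = xs" "f ` peaks S a d \<subseteq> B"
      using from_word by blast+
    show "\<forall>TU\<in>B. f ((\<lambda>(T, U). peak_word S T U) TU) = TU"
      "(\<lambda>(T, U). peak_word S T U) ` B \<subseteq> peaks S a d"
      using to_word by (auto simp: B_def)
  qed
  then have "card (peaks S a d) = card B" by (rule bij_betw_same_card)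
  also have "\<dots> = (\<Sum>T | T \<subseteq> S \<and> card T = k. card {U. U \<subseteq> S - T - {?M T} \<and> card U = a})"
    unfolding B_def using S by (intro card_SigmaI) auto
  also have "\<dots> = (\<Sum>T | T \<subseteq> S \<and> card T = k. (a + d) choose a)"
    by (rule sum.cong) (use S M in \<open>auto simp: n_subsets\<close>)
  also have "\<dots> = (card S choose k) * ((a + d) choose a)"
    using S by (simp add: n_subsets)
  finally show ?thesis .
qed

lemma words_last:
  assumes "finite S" "card S = a + d + 1"
  shows "words S a d = peaks S a d"
proof -
  have short: "sorted_wrt (<) ys" if "length ys \<le> 1" for ys :: "nat list"
    using that by (cases ys) auto
  have "sorted_wrt (<) (drop (a + d) xs) \<and> sorted_wrt (<) (drop (Suc (a + d)) xs)"
    if "xs \<in> permutations_of_set S" for xs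
    using length_finite_permutations_of_set[OF that] assms by (auto intro!: short)
  then show ?thesis
    by (auto simp: words_def peaks_def)
qed

text \<open>
  Compare the valley with its successor: an ascent gives a word with \<open>d\<close> descents, a descent one with
  \<open>Suc d\<close>.
\<close>

lemma peaks_split:
  assumes "finite S" "card S = a + d + 2 + k"
  shows "peaks S a d = words S a d \<union> words S a (Suc d)" "words S a d \<inter> words S a (Suc d) = {}"
proof -
  have key: "(xs \<in> peaks S a d \<longleftrightarrow> xs \<in> words S a d \<or> xs \<in> words S a (Suc d)) \<and>
      \<not> (xs \<in> words S a d \<and> xs \<in> words S a (Suc d))"
    if xs: "xs \<in> permutations_of_set S" for xs
  proof -
    define v w where "v = xs ! (a + d)" and "w = xs ! Suc (a + d)"
    have len: "length xs = a + d + 2 + k"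
      using length_finite_permutations_of_set[OF xs] assms by simp
    then have "v \<noteq> w"
      using permutations_of_setD(2)[OF xs] by (simp add: v_def w_def nth_eq_iff_index_eq)
    have d1: "drop (Suc (a + d)) xs = w # drop (Suc (Suc (a + d))) xs"
      using len by (simp add: w_def Cons_nth_drop_Suc)
    have d0: "drop (a + d) xs = v # w # drop (Suc (Suc (a + d))) xs"
      using len unfolding d1[symmetric] by (simp add: v_def Cons_nth_drop_Suc)
    have t1: "take (Suc d) (drop a xs) = take d (drop a xs) @ [v]"
      using len by (simp add: v_def take_Suc_conv_app_nth)
    have t2: "take (Suc (Suc d)) (drop a xs) = take d (drop a xs) @ [v, w]"
      using len by (simp add: v_def w_def take_Suc_conv_app_nth)
    show ?thesis
      using xs \<open>v \<noteq> w\<close> unfolding words_def peaks_def add_Suc_right mem_Collect_eq t1 t2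
      by (cases v w rule: linorder_cases) (auto simp: d0 d1 sorted_wrt_append intro: less_trans)
  qed
  then show "peaks S a d = words S a d \<union> words S a (Suc d)" "words S a d \<inter> words S a (Suc d) = {}"
    by (auto simp: peaks_def words_def)
qed

lemma card_words_split:
  assumes "finite S" "card S = a + d + 2 + k"
  shows "card (words S a d) + card (words S a (Suc d)) = (card S choose Suc k) * ((a + d) choose a)"
proof -
  have "finite (words S a e)" for e by (simp add: words_def)
  then have "card (words S a d) + card (words S a (Suc d)) = card (peaks S a d)"
    using peaks_split[OF assms] by (simp add: card_Un_disjoint)
  then show ?thesis using card_peaks[of S a d "Suc k"] assms by simp
qed

lemma card_words:
  assumes "finite S"
  shows "card S = a + d + 1 + k \<Longrightarrow> int (card (words S a d)) = ribbon (card S) a d k"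
proof (induction k arbitrary: d)
  case 0
  then show ?case using card_peaks[of S a d 0] words_last[of S a d] assms by simp
next
  case (Suc k)
  then have "int (card (words S a (Suc d))) = ribbon (card S) a (Suc d) k" by simp
  then show ?case
    using arg_cong[OF card_words_split[of S a d k], of int] assms Suc.prems by simp
qed

lemma image_Suc_add_lessThan: "(\<lambda>i. Suc (c + i)) ` {..<n} = {c + 1..c + n}"
proof (intro subset_antisym subsetI)
  fix x assume "x \<in> {c + 1..c + n}"
  then show "x \<in> (\<lambda>i. Suc (c + i)) ` {..<n}"
    by (intro image_eqI[of _ _ "x - Suc c"]) auto
qed auto

text \<open>
  A permutation of \<open>{1..m}\<close> is the same thing as its one-line notation; the entry at the zero-based
  position \<open>i\<close> of the list is the value at \<open>Suc i\<close>.
\<close>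

lemma card_up_down_up_permutations:
  "card (up_down_up_permutations n k) = card (words {1..2 * n + k + 1} n n)"
proof (rule bij_betw_same_card[of "\<lambda>\<sigma>. map \<sigma> [1..<2 * n + k + 2]"])
  let ?m = "2 * n + k + 1"
  let ?g = "\<lambda>\<sigma>. map \<sigma> [1..<2 * n + k + 2]"
  have nth: "?g \<sigma> ! i = \<sigma> (Suc i)" if "i < ?m" for \<sigma> :: "nat \<Rightarrow> nat" and i
    using that by (subst nth_map) (simp_all del: upt_Suc)
  have trans: "transp ((<) :: nat \<Rightarrow> nat \<Rightarrow> bool)" "transp ((>) :: nat \<Rightarrow> nat \<Rightarrow> bool)"
    by (auto simp: transp_def)
  have range: "set [1..<2 * n + k + 2] = {1..?m}" by auto
  have *: "?g \<sigma> \<in> words {1..?m} n n \<longleftrightarrow> \<sigma> \<in> up_down_up_permutations n k"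
    if perm: "\<sigma> permutes {1..?m}" for \<sigma>
  proof -
    define xs where "xs = ?g \<sigma>"
    have len: "length xs = ?m" by (simp add: xs_def del: upt_Suc)
    have nth: "xs ! i = \<sigma> (Suc i)" if "i < ?m" for i
      unfolding xs_def by (rule nth[OF that])
    have "xs \<in> permutations_of_set {1..?m}"
      unfolding xs_def permutations_of_set_def mem_Collect_eq set_map range distinct_map
      using permutes_image[OF perm] permutes_inj_on[OF perm] by simp
    moreover have "sorted_wrt (<) (take (Suc n) xs) \<longleftrightarrow> (\<forall>i\<in>{1..n}. \<sigma> i < \<sigma> (i + 1))"
    proof -
      have "sorted_wrt (<) (take (Suc n) xs) \<longleftrightarrow> (\<forall>i<n. \<sigma> (Suc i) < \<sigma> (Suc (Suc i)))"
        unfolding sorted_wrt_iff_nth_Suc_transp[OF trans(1)] using len nth by auto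
      also have "\<dots> \<longleftrightarrow> (\<forall>i\<in>{1..n}. \<sigma> i < \<sigma> (i + 1))"
        using ball_simps(9)[of Suc "{..<n}" "\<lambda>i. \<sigma> i < \<sigma> (i + 1)"]
        unfolding image_Suc_lessThan by auto
      finally show ?thesis .
    qed
    moreover have "sorted_wrt (>) (take (Suc n) (drop n xs)) \<longleftrightarrow>
        (\<forall>i\<in>{n + 1..2 * n}. \<sigma> i > \<sigma> (i + 1))"
    proof -
      have "sorted_wrt (>) (take (Suc n) (drop n xs)) \<longleftrightarrow>
          (\<forall>i<n. \<sigma> (Suc (n + i)) > \<sigma> (Suc (Suc (n + i))))"
        unfolding sorted_wrt_iff_nth_Suc_transp[OF trans(2)] using len nth by auto
      also have "\<dots> \<longleftrightarrow> (\<forall>i\<in>(\<lambda>i. Suc (n + i)) ` {..<n}. \<sigma> i > \<sigma> (i + 1))" by auto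
      also have "(\<lambda>i. Suc (n + i)) ` {..<n} = {n + 1..2 * n}"
        by (simp add: image_Suc_add_lessThan mult_2)
      finally show ?thesis .
    qed
    moreover have "sorted_wrt (<) (drop (n + n) xs) \<longleftrightarrow>
        (\<forall>i\<in>{2 * n + 1..2 * n + k}. \<sigma> i < \<sigma> (i + 1))"
    proof -
      have "sorted_wrt (<) (drop (n + n) xs) \<longleftrightarrow>
          (\<forall>i<k. \<sigma> (Suc (2 * n + i)) < \<sigma> (Suc (Suc (2 * n + i))))"
        unfolding sorted_wrt_iff_nth_Suc_transp[OF trans(1)] using len nth by (auto simp: mult_2)
      also have "\<dots> \<longleftrightarrow> (\<forall>i\<in>(\<lambda>i. Suc (2 * n + i)) ` {..<k}. \<sigma> i < \<sigma> (i + 1))" by auto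
      also have "(\<lambda>i. Suc (2 * n + i)) ` {..<k} = {2 * n + 1..2 * n + k}"
        by (simp add: image_Suc_add_lessThan)
      finally show ?thesis .
    qed
    ultimately show ?thesis
      using perm unfolding xs_def words_def up_down_up_permutations_def by blast
  qed
  have surj: "\<exists>\<sigma>. \<sigma> permutes {1..?m} \<and> ?g \<sigma> = xs" if "xs \<in> words {1..?m} n n" for xs
  proof -
    have xs: "set xs = {1..?m}" "distinct xs" "length xs = ?m"
      using that distinct_card[of xs] by (auto simp: words_def permutations_of_set_def)
    define \<sigma> where "\<sigma> i = (if i \<in> {1..?m} then xs ! (i - 1) else i)" for i
    have "?g \<sigma> = xs"
      by (rule nth_equalityI) (use xs nth in \<open>auto simp: \<sigma>_def simp del: upt_Suc\<close>)
    moreover have "inj_on \<sigma> {1..?m}"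
      using xs by (auto simp: inj_on_def \<sigma>_def nth_eq_iff_index_eq)
    moreover have "\<sigma> ` {1..?m} = {1..?m}"
      using arg_cong[OF \<open>?g \<sigma> = xs\<close>, of set] xs unfolding set_map range by simp
    ultimately have "\<sigma> permutes {1..?m}"
      by (intro bij_imp_permutes) (auto simp: bij_betw_def \<sigma>_def)
    with \<open>?g \<sigma> = xs\<close> show ?thesis by blast
  qed
  have inj: "inj_on ?g {\<sigma>. \<sigma> permutes {1..?m}}"
  proof (rule inj_onI)
    fix \<sigma> \<tau> assume p: "\<sigma> \<in> {\<sigma>. \<sigma> permutes {1..?m}}" "\<tau> \<in> {\<sigma>. \<sigma> permutes {1..?m}}"
      and "?g \<sigma> = ?g \<tau>"
    then have "\<sigma> i = \<tau> i" if "i \<in> {1..?m}" for i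
      using that range unfolding map_eq_conv by blast
    with p show "\<sigma> = \<tau>" by (metis ext mem_Collect_eq permutes_not_in)
  qed
  show "bij_betw ?g (up_down_up_permutations n k) (words {1..?m} n n)"
    unfolding bij_betw_def
  proof (intro conjI)
    show "inj_on ?g (up_down_up_permutations n k)"
      by (rule inj_on_subset[OF inj]) (auto simp: up_down_up_permutations_def)
    show "?g ` up_down_up_permutations n k = words {1..?m} n n"
      using * surj by (auto simp: up_down_up_permutations_def simp del: upt_Suc) blast+
  qed
qed

section \<open>Comparison of the two counts\<close>

theorem proposition5p10:
  fixes n k :: nat
  assumes "0 \<le> k" and "k \<le> n"
  shows "poly (P ((X 1 2 * X 2 3) ^ n * X 3 4 ^ k)) 0
           = int (card (up_down_up_permutations n k))"
proof -
  have "poly (P ((X 1 2 * X 2 3) ^ n * X 3 4 ^ k)) 0 = ribbon (2 * n + k + 1) n n k"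
    unfolding start_monomial P_monomial_at_zero[OF bounded_mono4] leaves_ribbon
    by (simp add: mult_2 add_ac)
  also have "\<dots> = int (card (words {1..2 * n + k + 1} n n))"
    by (subst card_words[of _ n n k]) simp_all
  finally show ?thesis unfolding card_up_down_up_permutations .
qed

end
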